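(* Let $\mathcal{B}$ be a betweenness on a finite set such that, for all elements $A,B,C,D$ of the ground set, $$(A,B,C)\in\mathcal{B}\ \text{ and }\ (A,D,B)\in\mathcal{B}\;\Rightarrow\;(A,D,C)\in\mathcal{B}.$$ Then $\mathcal{B}$ is an abstract causal betweenness.
   Context: A ternary relation $\mathcal{B}$ is a betweenness if for all $A,B,C$ in its ground set: $(A,B,C)\in\mathcal{B}$ implies that $A,B,C$ are all distinct; $(A,B,C)\in\mathcal{B}$ implies $(C,B,A)\in\mathcal{B}$; and $(A,B,C)\in\mathcal{B}$ implies $(C,A,B)\notin\mathcal{B}$. A finite probability space is an ordered pair $(S,p)$ where $S$ is a finite set and $p:S\to[0,1]$ is a function with $\sum_{s\in S}p(s)=1$. Subsets of $S$ are called events; for events $A,B$, write $AB=A\cap B$, $P(A)=\sum_{s\in A}p(s)$, and, when $P(B)>0$, $P(A|B)=P(AB)/P(B)$. An event $B$ is causally between events $A$ and $C$ if all of the following hold: (1) $P(AC)>P(A)\cdot P(C)$; (2) $P(C|B)>P(C|A)$; (3) $P(A|B)>P(A|C)$; (4) $P(AC|B)=P(A|B)\cdot P(C|B)$; (5) $P(B-A)>0$ and $P(B-C)>0$ (where $-$ denotes set difference). (The conditional probabilities are well defined, since (1) guarantees $P(A)>0$ and $P(C)>0$, and (5) guarantees $P(B)>0$.) Given a set $X$ of events in a finite probability space, $\mathcal{CB}(X)$ denotes the ternary relation on the ground set $X$ consisting of all ordered triples $(A,B,C)$ of events in $X$ satisfying (1)--(5). A ternary relation $\mathcal{B}$ on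 a finite ground set is an abstract causal betweenness if and only if there is a set $X$ of events in a finite probability space such that $\mathcal{CB}(X)$ is isomorphic to $\mathcal{B}$ (i.e. there is a bijection between the ground set of $\mathcal{B}$ and $X$ under which a triple is in $\mathcal{B}$ exactly when its image is in $\mathcal{CB}(X)$). *)

theory Defs
  imports Complex_Main
begin

definition betweenness :: "'a set \<Rightarrow> ('a \<times> 'a \<times> 'a) set \<Rightarrow> bool" where
  "betweenness V R \<longleftrightarrow> R \<subseteq> V \<times> V \<times> V \<and>
     (\<forall>A\<in>V. \<forall>B\<in>V. \<forall>C\<in>V.
        ((A, B, C) \<in> R \<longrightarrow> A \<noteq> B \<and> B \<noteq> C \<and> A \<noteq> C) \<and>
        ((A, B, C) \<in> R \<longrightarrow> (C, B, A) \<in> R) \<and>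
        ((A, B, C) \<in> R \<longrightarrow> (C, A, B) \<notin> R))"

text \<open>Points of \<open>S\<close> may have probability zero, and values of \<open>p\<close> outside \<open>S\<close> are irrelevant.\<close>

definition finite_prob_space :: "'s set \<Rightarrow> ('s \<Rightarrow> real) \<Rightarrow> bool" where
  "finite_prob_space S p \<longleftrightarrow>
     finite S \<and> (\<forall>s\<in>S. 0 \<le> p s \<and> p s \<le> 1) \<and> (\<Sum>s\<in>S. p s) = 1"

definition Pr :: "('s \<Rightarrow> real) \<Rightarrow> 's set \<Rightarrow> real" where
  "Pr p A = (\<Sum>s\<in>A. p s)"

text \<open>Only meaningful when \<open>Pr p B > 0\<close>; otherwise the quotient is 0 by the
  convention for division by zero.\<close>

definition cPr :: "('s \<Rightarrow> real) \<Rightarrow> 's set \<Rightarrow> 's set \<Rightarrow> real" where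
  "cPr p A B = Pr p (A \<inter> B) / Pr p B"

text \<open>For events in a finite probability space, the first conjunct forces \<open>A\<close> and \<open>C\<close>, and
  the last two force \<open>B\<close>, to have positive probability, so no conditional
  probability below is degenerate when all conjuncts hold.\<close>

definition causally_between ::
    "('s \<Rightarrow> real) \<Rightarrow> 's set \<Rightarrow> 's set \<Rightarrow> 's set \<Rightarrow> bool" where
  "causally_between p A B C \<longleftrightarrow>
     Pr p (A \<inter> C) > Pr p A * Pr p C \<and>
     cPr p C B > cPr p C A \<and>
     cPr p A B > cPr p A C \<and>
     cPr p (A \<inter> C) B = cPr p A B * cPr p C B \<and>
     Pr p (B - A) > 0 \<and> Pr p (B - C) > 0"

definition CB :: "('s \<Rightarrow> real) \<Rightarrow> 's set set \<Rightarrow> ('s set \<times> 's set \<times> 's set) set" where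
  "CB p X = {(A, B, C). A \<in> X \<and> B \<in> X \<and> C \<in> X \<and> causally_between p A B C}"

definition ternary_isomorphic ::
    "'a set \<Rightarrow> ('a \<times> 'a \<times> 'a) set \<Rightarrow> 'b set \<Rightarrow> ('b \<times> 'b \<times> 'b) set \<Rightarrow> bool" where
  "ternary_isomorphic V R W Q \<longleftrightarrow>
     (\<exists>f. bij_betw f V W \<and>
       (\<forall>A\<in>V. \<forall>B\<in>V. \<forall>C\<in>V. (A, B, C) \<in> R \<longleftrightarrow> (f A, f B, f C) \<in> Q))"

text \<open>HOL cannot quantify existentially over the type of sample points.  Taking the finite
  sample space to be a set of natural numbers loses nothing, as
  \<open>abstract_causal_betweennessI\<close> below shows.\<close>

definition abstract_causal_betweenness :: "'a set \<Rightarrow> ('a \<times> 'a \<times> 'a) set \<Rightarrow> bool" where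
  "abstract_causal_betweenness V R \<longleftrightarrow> finite V \<and> R \<subseteq> V \<times> V \<times> V \<and>
     (\<exists>(S :: nat set) p X. finite_prob_space S p \<and> X \<subseteq> Pow S \<and>
        ternary_isomorphic V R X (CB p X))"

lemma abstract_causal_betweennessI:
  fixes S :: "'s set"
  assumes "finite V" "R \<subseteq> V \<times> V \<times> V"
    and S: "finite_prob_space S p" and X: "X \<subseteq> Pow S"
    and iso: "ternary_isomorphic V R X (CB p X)"
  shows "abstract_causal_betweenness V R"
proof -
  have "finite S" using S by (simp add: finite_prob_space_def)
  then obtain g :: "'s \<Rightarrow> nat" where g: "inj_on g S"
    using finite_imp_inj_to_nat_seg by blast
  define q where "q = p \<circ> inv_into S g"
  have q: "q (g s) = p s" if "s \<in> S" for s
    using g that by (simp add: q_def)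
  have Pr: "Pr q (g ` A) = Pr p A" if "A \<subseteq> S" for A
  proof -
    have "Pr q (g ` A) = (\<Sum>s\<in>A. q (g s))"
      unfolding Pr_def using inj_on_subset[OF g that] by (simp add: sum.reindex)
    also have "\<dots> = Pr p A"
      unfolding Pr_def using that q by (intro sum.cong) auto
    finally show ?thesis .
  qed
  have Int: "g ` A \<inter> g ` B = g ` (A \<inter> B)" if "A \<subseteq> S" "B \<subseteq> S" for A B
    using inj_on_image_Int[OF g that] by simp
  have Diff: "g ` A - g ` B = g ` (A - B)" if "A \<subseteq> S" "B \<subseteq> S" for A B
    using inj_on_image_set_diff[OF g, of A B] that by auto
  have cPr: "cPr q (g ` A) (g ` B) = cPr p A B" if "A \<subseteq> S" "B \<subseteq> S" for A B
    using that by (simp add: cPr_def Int Pr le_infI1)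
  have cb: "causally_between q (g ` A) (g ` B) (g ` C) \<longleftrightarrow> causally_between p A B C"
    if "A \<subseteq> S" "B \<subseteq> S" "C \<subseteq> S" for A B C
  proof -
    have "A \<inter> C \<subseteq> S" "B - A \<subseteq> S" "B - C \<subseteq> S" using that by auto
    then show ?thesis using that by (simp add: causally_between_def Int Diff Pr cPr)
  qed
  have inj: "inj_on ((`) g) X"
    using inj_on_subset[OF inj_on_image_Pow[OF g] X] .
  have mem: "(g ` A, g ` B, g ` C) \<in> CB q ((`) g ` X) \<longleftrightarrow> (A, B, C) \<in> CB p X"
    if "A \<in> X" "B \<in> X" "C \<in> X" for A B C
    using that X cb[of A B C] by (auto simp: CB_def)
  obtain f where f: "bij_betw f V X"
    and fR: "\<And>A B C. A \<in> V \<Longrightarrow> B \<in> V \<Longrightarrow> C \<in> V \<Longrightarrow> (A, B, C) \<in> R \<longleftrightarrow> (f A, f B, f C) \<in> CB p X"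
    using iso by (auto simp: ternary_isomorphic_def)
  have fX: "f A \<in> X" if "A \<in> V" for A using f that by (auto simp: bij_betw_def)
  have "bij_betw ((`) g \<circ> f) V ((`) g ` X)"
    using f inj by (intro bij_betw_trans[OF f]) (simp add: bij_betw_def)
  then have "ternary_isomorphic V R ((`) g ` X) (CB q ((`) g ` X))"
    unfolding ternary_isomorphic_def
    by (intro exI[of _ "(`) g \<circ> f"]) (simp add: fR mem fX)
  moreover have "finite_prob_space (g ` S) q"
    using S g q by (simp add: finite_prob_space_def sum.reindex)
  moreover have "(`) g ` X \<subseteq> Pow (g ` S)" using X by blast
  ultimately show ?thesis
    unfolding abstract_causal_betweenness_def using assms(1,2) by blast
qed

end

theory Submission
  imports Defs
begin

text \<open>
  By the hypothesis, \<open>(A, B, C) \<in> \<B>\<close> makes the interval \<open>{D. (A, D, B) \<in> \<B>}\<close> a proper subset of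
  \<open>{D. (A, D, C) \<in> \<B>}\<close>: it is contained in it and misses \<open>B\<close>. So a weight \<open>w {A, B} > 1\<close> that
  strictly decreases with the size of the interval satisfies \<open>w {A, B} > w {A, C}\<close> and
  \<open>w {B, C} > w {A, C}\<close> for every such triple. It remains to find events with \<open>P(A) = \<alpha>\<close>,
  \<open>P(AB) = \<alpha>\<^sup>2 w {A, B}\<close>, and \<open>P(ABC) = \<alpha>\<^sup>3 w {A, B} w {B, C}\<close> if \<open>(A, B, C) \<in> \<B>\<close>, but \<open>P(ABC) = 0\<close>
  if no element of \<open>{A, B, C}\<close> is between the other two. Intersections of four or more
  events are given probability 0. If \<open>\<alpha>\<close> is small, the prescribed
  probabilities decay so fast that Moebius inversion on the subsets of the ground set yields
  nonnegative point masses.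
\<close>

section \<open>Moebius inversion on the subsets of a finite set\<close>

text \<open>Here \<open>m T\<close> prescribes the probability that a random subset of
  \<open>V\<close> contains \<open>T\<close>; the mass of \<open>T\<close> alone is what remains
  after all proper supersets. The recursion climbs to larger sets, and \<open>finite V\<close> makes
  the size of \<open>V - T\<close> a terminating measure.\<close>

function point_mass :: "'a set \<Rightarrow> ('a set \<Rightarrow> real) \<Rightarrow> 'a set \<Rightarrow> real" where
  "point_mass V m T =
     (if finite V then m T - (\<Sum>T' | T \<subset> T' \<and> T' \<subseteq> V. point_mass V m T') else 0)"
  by auto
termination
proof (relation "measure (\<lambda>(V, m, T). card (V - T))", goal_cases)
  case (2 V m T T')
  then have "V - T' \<subset> V - T" by auto
  then show ?case using 2 by (simp add: psubset_card_mono)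
qed simp

declare point_mass.simps [simp del]

lemma sum_point_mass:
  assumes "finite V" "T \<subseteq> V"
  shows "(\<Sum>T' | T \<subseteq> T' \<and> T' \<subseteq> V. point_mass V m T') = m T"
proof -
  have "{T'. T \<subseteq> T' \<and> T' \<subseteq> V} = insert T {T'. T \<subset> T' \<and> T' \<subseteq> V}" using assms by auto
  moreover have "finite {T'. T \<subset> T' \<and> T' \<subseteq> V}" using assms by simp
  ultimately show ?thesis using assms by (simp add: point_mass.simps[of V m T])
qed

text \<open>Induction from large sets to small ones. The upper bound is proved along with the lower
  one because it bounds the subtracted sum by the sum of \<open>m\<close> over proper supersets,
  which is at most \<open>m T\<close>.\<close>

lemma point_mass_bounds:
  assumes "finite V" and nonneg: "\<And>T. 0 \<le> m T"
    and dom: "\<And>T. T \<subseteq> V \<Longrightarrow> (\<Sum>T' | T \<subset> T' \<and> T' \<subseteq> V. m T') \<le> m T"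
    and "T \<subseteq> V"
  shows "0 \<le> point_mass V m T \<and> point_mass V m T \<le> m T"
  using \<open>T \<subseteq> V\<close>
proof (induction "card (V - T)" arbitrary: T rule: less_induct)
  case less
  have IH: "0 \<le> point_mass V m T' \<and> point_mass V m T' \<le> m T'" if "T \<subset> T'" "T' \<subseteq> V" for T'
  proof -
    have "V - T' \<subset> V - T" using that less by auto
    then show ?thesis using less that \<open>finite V\<close> by (simp add: psubset_card_mono)
  qed
  have "(\<Sum>T' | T \<subset> T' \<and> T' \<subseteq> V. point_mass V m T') \<le> (\<Sum>T' | T \<subset> T' \<and> T' \<subseteq> V. m T')"
    using IH by (intro sum_mono) auto
  moreover have "0 \<le> (\<Sum>T' | T \<subset> T' \<and> T' \<subseteq> V. point_mass V m T')"
    using IH by (intro sum_nonneg) auto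
  ultimately show ?case using dom[OF less.prems] \<open>finite V\<close> by (simp add: point_mass.simps[of V m T])
qed

section \<open>Weights of pairs and correlations of small sets\<close>

text \<open>Indexing by the unordered pair makes the weights symmetric by construction.\<close>

definition "interval R U = {D. \<exists>A B. U = {A, B} \<and> (A, D, B) \<in> R}"

definition weight :: "('a \<times> 'a \<times> 'a) set \<Rightarrow> 'a set \<Rightarrow> real" where
  "weight R U = 1 + 1 / (1 + real (card (interval R U)))"

definition "middles R U = {B. \<exists>A C. U = {A, B, C} \<and> (A, B, C) \<in> R}"

text \<open>\<open>middles R U\<close> has at most one element if \<open>R\<close> is a betweenness and \<open>U\<close> has three elements.\<close>

definition correlation :: "('a \<times> 'a \<times> 'a) set \<Rightarrow> 'a set \<Rightarrow> real" where
  "correlation R U =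
     (if card U \<le> 1 then 1
      else if card U = 2 then weight R U
      else if card U = 3 then (\<Sum>B\<in>middles R U. \<Prod>A\<in>U - {B}. weight R {A, B})
      else 0)"

lemma weight_bounds: "1 < weight R U" "weight R U \<le> 2"
  by (simp_all add: weight_def field_simps add_pos_nonneg)

locale finite_betweenness =
  fixes V :: "'a set" and R :: "('a \<times> 'a \<times> 'a) set"
  assumes finite: "finite V" and betweenness: "betweenness V R"
begin

lemma mem: "(A, B, C) \<in> R \<Longrightarrow> A \<in> V \<and> B \<in> V \<and> C \<in> V"
  using betweenness by (auto simp: betweenness_def)

lemma distinct: "(A, B, C) \<in> R \<Longrightarrow> A \<noteq> B \<and> B \<noteq> C \<and> A \<noteq> C"
  using betweenness mem unfolding betweenness_def by blast

lemma sym: "(A, B, C) \<in> R \<Longrightarrow> (C, B, A) \<in> R"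
  using betweenness mem unfolding betweenness_def by blast

lemma unique: "(A, B, C) \<in> R \<Longrightarrow> (C, A, B) \<notin> R"
  using betweenness mem unfolding betweenness_def by blast

lemma interval_pair: "interval R {A, B} = {D. (A, D, B) \<in> R}"
  using sym by (auto simp: interval_def doubleton_eq_iff)

text \<open>Another middle would be \<open>A\<close> or \<open>C\<close>; the third betweenness
  axiom excludes the one directly and the other after reversing the triple.\<close>

lemma middles_triple:
  assumes "(A, B, C) \<in> R"
  shows "middles R {A, B, C} = {B}"
proof -
  have "B' = B" if "{A, B, C} = {A', B', C'}" "(A', B', C') \<in> R" for A' B' C'
  proof (rule ccontr)
    assume "B' \<noteq> B"
    then have "B' = A \<or> B' = C" using that by auto
    moreover have "A' \<in> {A, B, C}" "C' \<in> {A, B, C}" using that by auto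
    ultimately show False
      using assms that(2) distinct[OF that(2)] unique sym by blast
  qed
  then show ?thesis using assms by (auto simp: middles_def)
qed

lemma correlation_triple:
  assumes "(A, B, C) \<in> R"
  shows "correlation R {A, B, C} = weight R {A, B} * weight R {B, C}"
proof -
  have *: "A \<noteq> B" "B \<noteq> C" "A \<noteq> C" using distinct[OF assms] by auto
  then have "{A, B, C} - {B} = {A, C}" "card {A, B, C} = 3" by auto
  then show ?thesis
    using * by (simp add: correlation_def middles_triple[OF assms] insert_commute[of C B "{}"])
qed

text \<open>The sum over an empty set of middles is 0, so a nonzero correlation of three elements
  exhibits a triple of \<open>R\<close>.\<close>

lemma correlation_triple_cases:
  assumes "card U = 3"
  obtains A B C where "(A, B, C) \<in> R" "U = {A, B, C}" | "middles R U = {}" "correlation R U = 0"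
proof (cases "middles R U = {}")
  case True
  then show ?thesis using assms that(2) by (simp add: correlation_def)
next
  case False
  then show ?thesis using that(1) by (auto simp: middles_def)
qed

lemma correlation_bounds: "0 \<le> correlation R U \<and> correlation R U \<le> 4"
proof (cases "card U = 3")
  case True
  then show ?thesis
  proof (cases rule: correlation_triple_cases)
    case (1 A B C)
    have "weight R {A, B} * weight R {B, C} \<le> 2 * 2"
      using weight_bounds[of R "{A, B}"] weight_bounds[of R "{B, C}"] by (intro mult_mono) auto
    then show ?thesis
      using 1 weight_bounds(1)[of R "{A, B}"] weight_bounds(1)[of R "{B, C}"]
      by (simp add: correlation_triple)
  qed simp
next
  case False
  then show ?thesis using weight_bounds[of R U] by (simp add: correlation_def)
qed

lemma one_le_correlation: "card U \<le> 2 \<Longrightarrow> 1 \<le> correlation R U"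
  using weight_bounds(1)[of R U] by (simp add: correlation_def)

section \<open>The random subset of \<open>V\<close> and its events\<close>

text \<open>The factor 4 absorbs the upper bound on correlations, and \<open>2 ^ card V\<close> the
  number of supersets to be summed over.\<close>

definition "\<alpha> = 1 / (4 * 2 ^ card V :: real)"

definition "joint U = \<alpha> ^ card U * correlation R U"

lemma \<alpha>_bounds: "0 < \<alpha>" "\<alpha> \<le> 1 / 4"
  by (simp_all add: \<alpha>_def field_simps)

lemma joint_nonneg: "0 \<le> joint U"
  using correlation_bounds[of U] \<alpha>_bounds by (simp add: joint_def)

text \<open>A larger set costs at least one more factor \<alpha>, and \<alpha> times the largest
  correlation is at most \<open>1 / 2 ^ card V\<close>.\<close>

lemma joint_decay:
  assumes "T \<subset> U" "U \<subseteq> V"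
  shows "joint U \<le> joint T / 2 ^ card V"
proof -
  have "finite U" using assms finite finite_subset by blast
  then have less: "card T < card U" using assms psubset_card_mono by blast
  show ?thesis
  proof (cases "card T \<le> 2")
    case True
    have "joint U \<le> \<alpha> ^ Suc (card T) * 4"
      unfolding joint_def using less \<alpha>_bounds correlation_bounds
      by (intro mult_mono power_decreasing) auto
    also have "\<dots> = \<alpha> ^ card T * 1 / 2 ^ card V" by (simp add: \<alpha>_def)
    also have "\<dots> \<le> joint T / 2 ^ card V"
      unfolding joint_def using \<alpha>_bounds one_le_correlation[OF True]
      by (intro divide_right_mono mult_left_mono) auto
    finally show ?thesis .
  next
    case False
    \<comment> \<open>Here \<open>correlation R T\<close> may vanish, but \<open>U\<close> has at
      least four elements, so its own correlation is 0.\<close>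
    then have "joint U = 0" using less by (simp add: joint_def correlation_def)
    then show ?thesis using joint_nonneg by simp
  qed
qed

lemma sum_joint_le:
  assumes "T \<subseteq> V"
  shows "(\<Sum>U | T \<subset> U \<and> U \<subseteq> V. joint U) \<le> joint T"
proof -
  have "(\<Sum>U | T \<subset> U \<and> U \<subseteq> V. joint U) \<le> (\<Sum>U | T \<subset> U \<and> U \<subseteq> V. joint T / 2 ^ card V)"
    using joint_decay by (intro sum_mono) auto
  also have "\<dots> \<le> (\<Sum>U\<in>Pow V. joint T / 2 ^ card V)"
    using finite joint_nonneg by (intro sum_mono2) auto
  also have "\<dots> = joint T" using finite by (simp add: card_Pow)
  finally show ?thesis .
qed

definition "p = point_mass V joint"

text \<open>Sample points are subsets of \<open>V\<close>, so intersecting the events of the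
  elements of \<open>U\<close> gives the sets \<open>T\<close> that contain
  \<open>U\<close>.\<close>

definition "event A = {T. A \<in> T \<and> T \<subseteq> V}"

lemma p_nonneg: "T \<subseteq> V \<Longrightarrow> 0 \<le> p T"
  using point_mass_bounds[of V joint T] finite joint_nonneg sum_joint_le by (simp add: p_def)

lemma prob_space: "finite_prob_space (Pow V) p"
proof -
  \<comment> \<open>Every sample point contains the empty set, so this value is the total
    mass.\<close>
  have "joint {} = 1" by (simp add: joint_def correlation_def)
  then have sum: "(\<Sum>T\<in>Pow V. p T) = 1"
    using sum_point_mass[OF finite, of "{}" joint] by (simp add: p_def Pow_def)
  moreover have "p T \<le> 1" if "T \<in> Pow V" for T
    using member_le_sum[of T "Pow V" p] that p_nonneg finite sum by auto
  ultimately show ?thesis using finite p_nonneg by (simp add: finite_prob_space_def)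
qed

lemma Pr_joint: "U \<subseteq> V \<Longrightarrow> Pr p {T. U \<subseteq> T \<and> T \<subseteq> V} = joint U"
  using sum_point_mass[OF finite, of U joint] by (simp add: Pr_def p_def)

lemma Pr_event: "A \<in> V \<Longrightarrow> Pr p (event A) = \<alpha>"
  using Pr_joint[of "{A}"] by (simp add: event_def joint_def correlation_def)

lemma Pr_event2:
  assumes "A \<in> V" "B \<in> V" "A \<noteq> B"
  shows "Pr p (event A \<inter> event B) = \<alpha>\<^sup>2 * weight R {A, B}"
proof -
  have "event A \<inter> event B = {T. {A, B} \<subseteq> T \<and> T \<subseteq> V}" by (auto simp: event_def)
  then show ?thesis using Pr_joint[of "{A, B}"] assms
    by (simp add: joint_def correlation_def power2_eq_square)
qed

lemma Pr_event3:
  assumes "A \<in> V" "B \<in> V" "C \<in> V" "A \<noteq> B" "B \<noteq> C" "A \<noteq> C"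
  shows "Pr p (event A \<inter> event C \<inter> event B) = \<alpha> ^ 3 * correlation R {A, B, C}"
proof -
  have "event A \<inter> event C \<inter> event B = {T. {A, B, C} \<subseteq> T \<and> T \<subseteq> V}" by (auto simp: event_def)
  moreover have "card {A, B, C} = 3" using assms by simp
  ultimately show ?thesis using Pr_joint[of "{A, B, C}"] assms
    by (simp add: joint_def power3_eq_cube)
qed

text \<open>The overlap takes at most half of \<open>event B\<close>, since \<alpha> is at most 1/4
  and weights are at most 2.\<close>

lemma Pr_event_diff:
  assumes "A \<in> V" "B \<in> V" "A \<noteq> B"
  shows "Pr p (event B - event A) > 0"
proof -
  have "finite (event B)" using finite by (simp add: event_def)
  then have "Pr p (event B - event A) = Pr p (event B) - Pr p (event A \<inter> event B)"
    unfolding Pr_def by (simp add: sum.Int_Diff[of "event B" p "event A"] Int_commute)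
  also have "\<dots> = \<alpha> - \<alpha> * (\<alpha> * weight R {A, B})"
    using assms by (simp add: Pr_event Pr_event2 power2_eq_square)
  also have "\<dots> > 0"
  proof -
    have "\<alpha> * weight R {A, B} \<le> 1 / 4 * 2"
      using \<alpha>_bounds weight_bounds[of R "{A, B}"] by (intro mult_mono) auto
    then show ?thesis using \<alpha>_bounds by simp
  qed
  finally show ?thesis .
qed

text \<open>All events have probability \<alpha>, so its powers cancel from the comparisons.
  Positive correlation of \<open>event A\<close> and \<open>event C\<close> holds because weights
  exceed 1.\<close>

lemma causally_between_event_iff:
  assumes "A \<in> V" "B \<in> V" "C \<in> V" "A \<noteq> B" "B \<noteq> C" "A \<noteq> C"
  shows "causally_between p (event A) (event B) (event C) \<longleftrightarrow>
    weight R {B, C} > weight R {A, C} \<and> weight R {A, B} > weight R {A, C} \<and>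
    correlation R {A, B, C} = weight R {A, B} * weight R {B, C}"
proof -
  have a: "\<alpha> > 0" by (rule \<alpha>_bounds)
  have cPr2: "cPr p (event X) (event Y) = \<alpha> * weight R {X, Y}"
    if "X \<in> V" "Y \<in> V" "X \<noteq> Y" for X Y
    using that a by (simp add: cPr_def Pr_event Pr_event2 power2_eq_square)
  have cPr3: "cPr p (event A \<inter> event C) (event B) = \<alpha>\<^sup>2 * correlation R {A, B, C}"
    using assms a by (simp add: cPr_def Pr_event Pr_event3 power2_eq_square power3_eq_cube)
  have "Pr p (event A \<inter> event C) > Pr p (event A) * Pr p (event C)"
    using assms a weight_bounds(1)[of R "{A, C}"]
    by (simp add: Pr_event Pr_event2 power2_eq_square)
  then show ?thesis
    unfolding causally_between_def
    using assms a Pr_event_diff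
    by (simp add: cPr2 cPr3 power2_eq_square insert_commute[of C B "{}"] insert_commute[of C A "{}"])
qed

text \<open>If \<open>A = C\<close>, a conditional probability would exceed 1; if \<open>B\<close>
  equals \<open>A\<close> or \<open>C\<close>, a difference required to have positive probability is
  empty.\<close>

lemma causally_between_event_distinct:
  assumes "A \<in> V" "B \<in> V" "C \<in> V" "causally_between p (event A) (event B) (event C)"
  shows "A \<noteq> B \<and> B \<noteq> C \<and> A \<noteq> C"
proof -
  have "A \<noteq> C"
  proof
    assume "A = C"
    then have "cPr p (event A) (event B) > cPr p (event A) (event A)"
      using assms(4) unfolding causally_between_def by blast
    then have "Pr p (event A \<inter> event B) > Pr p (event B)"
      using assms(1-3) \<alpha>_bounds by (simp add: cPr_def Pr_event)
    moreover have "Pr p (event A \<inter> event B) \<le> Pr p (event B)"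
      unfolding Pr_def using finite p_nonneg
      by (intro sum_mono2) (auto simp: event_def)
    ultimately show False by simp
  qed
  then show ?thesis using assms by (auto simp: causally_between_def Pr_def)
qed

end

section \<open>Recovering the betweenness from the events\<close>

theorem corollary1:
  fixes V :: "'a set" and \<B> :: "('a \<times> 'a \<times> 'a) set"
  assumes "finite V"
    and "betweenness V \<B>"
    and "\<And>A B C D. A \<in> V \<Longrightarrow> B \<in> V \<Longrightarrow> C \<in> V \<Longrightarrow> D \<in> V \<Longrightarrow>
           (A, B, C) \<in> \<B> \<Longrightarrow> (A, D, B) \<in> \<B> \<Longrightarrow> (A, D, C) \<in> \<B>"
  shows "abstract_causal_betweenness V \<B>"
proof -
  interpret finite_betweenness V \<B> by unfold_locales (use assms in auto)
  have mono: "weight \<B> {A, B} > weight \<B> {A, C}" if "(A, B, C) \<in> \<B>" for A B C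
  proof -
    have "interval \<B> {A, B} \<subset> interval \<B> {A, C}"
      using that assms(3) mem distinct unfolding interval_pair by blast
    moreover have "interval \<B> {A, C} \<subseteq> V" using mem by (auto simp: interval_pair)
    ultimately have "card (interval \<B> {A, B}) < card (interval \<B> {A, C})"
      using \<open>finite V\<close> by (meson finite_subset psubset_card_mono)
    then show ?thesis by (simp add: weight_def frac_less2)
  qed
  have iff: "(A, B, C) \<in> \<B> \<longleftrightarrow> causally_between p (event A) (event B) (event C)"
    if V: "A \<in> V" "B \<in> V" "C \<in> V" for A B C
  proof
    assume R: "(A, B, C) \<in> \<B>"
    then show "causally_between p (event A) (event B) (event C)"
      using V distinct[OF R] mono[OF R] mono[OF sym[OF R]]
      by (simp add: causally_between_event_iff correlation_triple insert_commute)
  next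
    assume cb: "causally_between p (event A) (event B) (event C)"
    have ne: "A \<noteq> B" "B \<noteq> C" "A \<noteq> C" using causally_between_event_distinct[OF V cb] by auto
    have w: "weight \<B> {B, C} > weight \<B> {A, C}" "weight \<B> {A, B} > weight \<B> {A, C}"
      and corr: "correlation \<B> {A, B, C} = weight \<B> {A, B} * weight \<B> {B, C}"
      using cb causally_between_event_iff[OF V ne] by auto
    \<comment> \<open>A product of weights is positive, which forces one of the three elements to be
      a middle.\<close>
    have "correlation \<B> {A, B, C} \<noteq> 0"
      using corr weight_bounds(1)[of \<B> "{A, B}"] weight_bounds(1)[of \<B> "{B, C}"] by simp
    moreover have "card {A, B, C} = 3" using ne by simp
    ultimately obtain A' B' C' where R: "(A', B', C') \<in> \<B>" and eq: "{A, B, C} = {A', B', C'}"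
      by (auto elim: correlation_triple_cases)
    have w': "weight \<B> {A', B'} > weight \<B> {A', C'}" "weight \<B> {B', C'} > weight \<B> {A', C'}"
      using mono[OF R] mono[OF sym[OF R]] by (simp_all add: insert_commute)
    have elems: "A' \<in> {A, B, C}" "B' \<in> {A, B, C}" "C' \<in> {A, B, C}"
      by (simp_all add: eq)
    \<comment> \<open>In a triple of \<open>\<B>\<close> the pair opposite the middle has strictly
      the least weight; by \<open>w\<close> that pair is \<open>{A, C}\<close>.\<close>
    have "B' = B"
    proof (rule ccontr)
      assume "B' \<noteq> B"
      then have "B' = A \<and> {A', C'} = {B, C} \<or> B' = C \<and> {A', C'} = {B, A}"
        using elems distinct[OF R] by auto
      then show False using w w' by (auto simp: doubleton_eq_iff insert_commute)
    qed
    then have "A' = A \<and> C' = C \<or> A' = C \<and> C' = A"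
      using elems distinct[OF R] by auto
    then show "(A, B, C) \<in> \<B>" using R \<open>B' = B\<close> sym by auto
  qed
  have "inj_on event V"
  proof (rule inj_onI)
    fix A B assume "A \<in> V" "B \<in> V" "event A = event B"
    \<comment> \<open>The singleton \<open>{A}\<close> is a sample point that lies in the event of
      \<open>A\<close> only.\<close>
    then have "{A} \<in> event B" by (auto simp: event_def)
    then show "A = B" by (simp add: event_def)
  qed
  then have "ternary_isomorphic V \<B> (event ` V) (CB p (event ` V))"
    unfolding ternary_isomorphic_def using iff
    by (intro exI[of _ event]) (auto simp: CB_def bij_betw_def)
  moreover have "event ` V \<subseteq> Pow (Pow V)" by (auto simp: event_def)
  moreover have "\<B> \<subseteq> V \<times> V \<times> V" using mem by auto
  ultimately show ?thesis
    by (intro abstract_causal_betweennessI[OF \<open>finite V\<close> _ prob_space])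
qed

end
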